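(* Let $\sigma$ be a weak selection for a set $X$ such that the selection topology $\mathscr{T}_\sigma$ is a compact topology on $X$. Then $X$ has a quasi $\sigma$-king.
   Context: For a set $X$, let $\mathscr{F}_2(X)=\{S\subset X: 1\le |S|\le 2\}$. A weak selection for $X$ is a map $\sigma:\mathscr{F}_2(X)\to X$ with $\sigma(S)\in S$ for every $S\in\mathscr{F}_2(X)$. It generates the (total, antisymmetric, not necessarily transitive) relation $x\leq_\sigma y$ iff $\sigma(\{x,y\})=x$; write $x<_\sigma y$ if $x\leq_\sigma y$ and $x\neq y$. The selection topology $\mathscr{T}_\sigma$ on $X$ is the topology with subbase consisting of all sets $\{y\in X: y<_\sigma x\}$ and $\{y\in X: x<_\sigma y\}$, $x\in X$. A point $q\in X$ is a quasi $\sigma$-king if for each $x\in X$ there are finitely many points $y_1,\dots,y_n\in X$ with $x\leq_\sigma y_1\leq_\sigma\dots\leq_\sigma y_n\leq_\sigma q$. *)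

theory Defs
  imports "HOL-Analysis.Abstract_Topology"
begin

(* card is 0 on infinite sets, so the lower bound also forces finiteness. *)
definition F2 :: "'a set \<Rightarrow> 'a set set" where
  "F2 X = {S. S \<subseteq> X \<and> 1 \<le> card S \<and> card S \<le> 2}"

(* Only the values of the selection on F2 X are relevant. *)
definition weak_selection :: "'a set \<Rightarrow> ('a set \<Rightarrow> 'a) \<Rightarrow> bool" where
  "weak_selection X \<sigma> \<longleftrightarrow> (\<forall>S \<in> F2 X. \<sigma> S \<in> S)"

definition sel_le :: "('a set \<Rightarrow> 'a) \<Rightarrow> 'a \<Rightarrow> 'a \<Rightarrow> bool" where
  "sel_le \<sigma> x y \<longleftrightarrow> \<sigma> {x, y} = x"

definition sel_less :: "('a set \<Rightarrow> 'a) \<Rightarrow> 'a \<Rightarrow> 'a \<Rightarrow> bool" where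
  "sel_less \<sigma> x y \<longleftrightarrow> sel_le \<sigma> x y \<and> x \<noteq> y"

(* X itself is added as the empty intersection of subbasic sets: the carrier of
   topology_generated_by is the union of the generating family, which would be empty
   for a singleton X. For all other X the rays already cover X. *)
definition selection_topology :: "'a set \<Rightarrow> ('a set \<Rightarrow> 'a) \<Rightarrow> 'a topology" where
  "selection_topology X \<sigma> = topology_generated_by
     ({X} \<union> (\<Union>x\<in>X. {{y \<in> X. sel_less \<sigma> y x}, {y \<in> X. sel_less \<sigma> x y}}))"

(* The chain x \<le> y_1 \<le> ... \<le> y_n \<le> q, with n \<ge> 1, is encoded by the list [y_1, ..., y_n]. *)
definition quasi_king :: "'a set \<Rightarrow> ('a set \<Rightarrow> 'a) \<Rightarrow> 'a \<Rightarrow> bool" where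
  "quasi_king X \<sigma> q \<longleftrightarrow> q \<in> X \<and>
     (\<forall>x\<in>X. \<exists>ys. ys \<noteq> [] \<and> set ys \<subseteq> X \<and> successively (sel_le \<sigma>) (x # ys @ [q]))"

end

theory Submission
  imports Defs
begin

text \<open>
  Call \<open>y\<close> reachable from \<open>x\<close> if a finite chain leads up from \<open>x\<close> to \<open>y\<close>. Any two points
  are comparable under \<open>\<le>\<^sub>\<sigma>\<close>, so reachability is a total preorder, unlike \<open>\<le>\<^sub>\<sigma>\<close> itself, which
  need not be transitive. A quasi king is a greatest element of this preorder, and every finite
  nonempty set of points has a greatest element (\<open>finite_has_most_reachable\<close>).

  Compactness reduces the general case to the finite one. If some point has nothing strictly above
  it, every point lies below it in one step and it is a quasi king. Otherwise the open rays
  \<open>{y. y <\<^sub>\<sigma> x}\<close> cover \<open>X\<close>, and a finite set \<open>A\<close> of their endpoints already suffices to cover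
  it. Each point of \<open>X\<close> then lies below an element of \<open>A\<close>, from which the most reachable
  element of \<open>A\<close> is reached.
\<close>

abbreviation sel_le_on :: "'a set \<Rightarrow> ('a set \<Rightarrow> 'a) \<Rightarrow> 'a \<Rightarrow> 'a \<Rightarrow> bool" where
  "sel_le_on X \<sigma> x y \<equiv> x \<in> X \<and> y \<in> X \<and> sel_le \<sigma> x y"

lemma sel_le_total:
  assumes "weak_selection X \<sigma>" and "x \<in> X" and "y \<in> X"
  shows "sel_le \<sigma> x y \<or> sel_le \<sigma> y x"
proof -
  have "{x, y} \<in> F2 X"
    using assms(2,3) by (cases "x = y") (auto simp: F2_def)
  then have "\<sigma> {x, y} \<in> {x, y}"
    using assms(1) unfolding weak_selection_def by blast
  then show ?thesis
    unfolding sel_le_def by (auto simp: insert_commute)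
qed

text \<open>
  The chain read off from reachability may have no intermediate point, while a quasi king asks for
  at least one. Reflexivity at \<open>q\<close> supplies it: \<open>q\<close> is repeated at the end.
\<close>

lemma quasi_kingI:
  assumes sel: "weak_selection X \<sigma>" and q: "q \<in> X"
    and reach: "\<And>x. x \<in> X \<Longrightarrow> (sel_le_on X \<sigma>)\<^sup>*\<^sup>* x q"
  shows "quasi_king X \<sigma> q"
proof -
  have "\<exists>ys. ys \<noteq> [] \<and> set ys \<subseteq> X \<and> successively (sel_le \<sigma>) (x # ys @ [q])"
    if "x \<in> X" for x
    using reach[OF that]
  proof (induction rule: converse_rtranclp_induct)
    case base
    have "sel_le \<sigma> q q" using sel_le_total[OF sel q q] by blast
    then show ?case using q by (intro exI[of _ "[q]"]) simp
  next
    case (step x y)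
    then obtain ys where "set ys \<subseteq> X" "successively (sel_le \<sigma>) (y # ys @ [q])"
      by blast
    then show ?case using step.hyps(1) by (intro exI[of _ "y # ys"]) simp
  qed
  then show ?thesis unfolding quasi_king_def using q by blast
qed

lemma finite_has_most_reachable:
  assumes "finite A" and "A \<noteq> {}" and "A \<subseteq> X" and sel: "weak_selection X \<sigma>"
  shows "\<exists>q\<in>A. \<forall>a\<in>A. (sel_le_on X \<sigma>)\<^sup>*\<^sup>* a q"
  using assms(1-3)
proof (induction rule: finite_ne_induct)
  case (singleton x)
  then show ?case by simp
next
  case (insert x A)
  then obtain q where q: "q \<in> A" "\<forall>a\<in>A. (sel_le_on X \<sigma>)\<^sup>*\<^sup>* a q"
    by blast
  have X: "x \<in> X" "q \<in> X" using insert.prems q(1) by auto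
  show ?case
  proof (cases "sel_le \<sigma> x q")
    case True
    then have "(sel_le_on X \<sigma>)\<^sup>*\<^sup>* x q" using X by (intro r_into_rtranclp) simp
    then show ?thesis using q by blast
  next
    case False
    then have "sel_le_on X \<sigma> q x" using sel_le_total[OF sel X] X by blast
    then have "(sel_le_on X \<sigma>)\<^sup>*\<^sup>* a x" if "a \<in> A" for a
      using rtranclp.rtrancl_into_rtrancl[OF bspec[OF q(2) that]] by blast
    then show ?thesis by blast
  qed
qed

lemma topspace_selection_topology [simp]: "topspace (selection_topology X \<sigma>) = X"
  unfolding selection_topology_def topology_generated_by_topspace by auto

lemma openin_selection_topology_lower_ray:
  "x \<in> X \<Longrightarrow> openin (selection_topology X \<sigma>) {y \<in> X. sel_less \<sigma> y x}"
  unfolding selection_topology_def by (rule topology_generated_by_Basis) auto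

theorem theorem3p4:
  fixes X :: "'a set" and \<sigma> :: "'a set \<Rightarrow> 'a"
  assumes "X \<noteq> {}"
    and "weak_selection X \<sigma>"
    and "compact_space (selection_topology X \<sigma>)"
  shows "\<exists>q. quasi_king X \<sigma> q"
proof (cases "\<exists>q\<in>X. \<forall>x\<in>X. \<not> sel_less \<sigma> q x")
  case True
  then obtain q where q: "q \<in> X" "\<forall>x\<in>X. \<not> sel_less \<sigma> q x" by blast
  have "(sel_le_on X \<sigma>)\<^sup>*\<^sup>* x q" if "x \<in> X" for x
  proof (cases "x = q")
    case False
    then have "sel_le \<sigma> x q"
      using q sel_le_total[OF assms(2) that q(1)] that by (auto simp: sel_less_def)
    then show ?thesis using that q(1) by (intro r_into_rtranclp) simp
  qed simp
  then show ?thesis using quasi_kingI[OF assms(2) q(1)] by blast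
next
  case False
  define ray where "ray x = {y \<in> X. sel_less \<sigma> y x}" for x
  have "X \<subseteq> \<Union> (ray ` X)"
    using False unfolding ray_def by blast
  moreover have "openin (selection_topology X \<sigma>) U" if "U \<in> ray ` X" for U
    using that by (auto simp: ray_def openin_selection_topology_lower_ray)
  moreover have "compactin (selection_topology X \<sigma>) X"
    using assms(3) by (simp add: compact_space_def)
  ultimately have "\<exists>\<F>. finite \<F> \<and> \<F> \<subseteq> ray ` X \<and> X \<subseteq> \<Union> \<F>"
    by (simp add: compactin_def)
  then obtain \<F> where \<F>: "finite \<F>" "\<F> \<subseteq> ray ` X" "X \<subseteq> \<Union> \<F>"
    by (elim exE conjE)
  then obtain A where A: "A \<subseteq> X" "finite A" "\<F> = ray ` A"
    by (meson finite_subset_image)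
  then have "A \<noteq> {}" using \<F>(3) assms(1) by auto
  then obtain q where q: "q \<in> A" "\<forall>a\<in>A. (sel_le_on X \<sigma>)\<^sup>*\<^sup>* a q"
    using finite_has_most_reachable[OF A(2) _ A(1) assms(2)] by blast
  have "(sel_le_on X \<sigma>)\<^sup>*\<^sup>* x q" if "x \<in> X" for x
  proof -
    obtain a where "a \<in> A" "x \<in> ray a" using \<F>(3) A(3) \<open>x \<in> X\<close> by blast
    then have "sel_le_on X \<sigma> x a" using A(1) by (auto simp: ray_def sel_less_def)
    then show ?thesis
      using converse_rtranclp_into_rtranclp[OF _ bspec[OF q(2) \<open>a \<in> A\<close>]] by blast
  qed
  moreover have "q \<in> X" using q(1) A(1) by blast
  ultimately show ?thesis using quasi_kingI[OF assms(2)] by blast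
qed

end
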